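(* The additivity of the ideal $\mathcal{M}$ of microscopic subsets of $\mathbb{R}$ is equal to $\omega_1$ (provably in ZFC); i.e., $\min\{\mathrm{card}(\mathcal{A}):\mathcal{A}\subset\mathcal{M},\ \bigcup\mathcal{A}\notin\mathcal{M}\}=\omega_1$.
   Context: A set $M\subset\mathbb{R}$ is microscopic if for each $\varepsilon>0$ there is a sequence of intervals $(J_n)_{n\in\omega}$ with $M\subset\bigcup_n J_n$ and $|J_n|\leq\varepsilon^{n+1}$ for each $n\in\omega$, where $|J|$ is the length of the interval $J$. $\mathcal{M}$ denotes the family of all microscopic sets. *)

theory Defs
  imports "HOL-Analysis.Analysis"
begin

unbundle cardinal_syntax

text \<open>
  Intervals may be open, closed, half-open, degenerate or empty. Their length is taken as an
  extended nonnegative real, so that unbounded intervals have length infinity (the real-valued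
  \<^const>\<open>measure\<close> would give them length 0).
\<close>

definition interval_length :: "real set \<Rightarrow> ennreal" where
  "interval_length J = emeasure lborel J"

definition microscopic :: "real set \<Rightarrow> bool" where
  "microscopic M \<longleftrightarrow>
    (\<forall>\<epsilon>::real. \<epsilon> > 0 \<longrightarrow>
      (\<exists>J :: nat \<Rightarrow> real set.
        (\<forall>n. is_interval (J n)) \<and>
        M \<subseteq> (\<Union>n. J n) \<and>
        (\<forall>n. interval_length (J n) \<le> ennreal (\<epsilon> ^ (n + 1)))))"

text \<open>
  Cardinals on different types are compared with \<open>=o\<close> and \<open>\<le>o\<close>, so the minimum of a class of
  cardinals is determined only up to \<open>=o\<close>. Hence \<open>\<kappa> = add(I)\<close> is rendered as a relation:
  \<open>\<kappa>\<close> is attained by a family of members of \<open>I\<close> with union outside \<open>I\<close>, and is a lower bound for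
  the cardinalities of all such families.
\<close>

definition has_additivity :: "'a set set \<Rightarrow> 'b rel \<Rightarrow> bool" where
  "has_additivity I \<kappa> \<longleftrightarrow>
    (\<exists>\<A>. \<A> \<subseteq> I \<and> \<Union>\<A> \<notin> I \<and> |\<A>| =o \<kappa>) \<and>
    (\<forall>\<A>. \<A> \<subseteq> I \<and> \<Union>\<A> \<notin> I \<longrightarrow> \<kappa> \<le>o |\<A>| )"

definition omega1 :: "nat set rel" where
  "omega1 = cardSuc natLeq"

end

theory Submission
  imports Defs "HOL-Library.Discrete_Functions" "HOL-Library.Countable_Set_Type"
begin

text \<open>
  Countable unions of microscopic sets are microscopic since \<open>2 ^ m * (2 * k + 1)\<close> enumerates
  the positive integers. For the upper bound, each \<open>\<alpha> \<subseteq> \<nat>\<close> gives a tree of nested closed cells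
  whose level-\<open>k\<close> cells can be enumerated with the \<open>n\<close>-th one shorter than \<open>2 ^ -(k n)\<close>; the set
  \<open>limset \<alpha>\<close> of its limits is therefore microscopic. Suppose that intervals \<open>J n\<close> of length at
  most \<open>16 ^ -(n + 1)\<close> cover \<open>limset \<alpha>\<close> for uncountably many \<open>\<alpha>\<close>. Call a cell of length \<open>2 ^ -e\<close> alive
  if it misses \<open>J n\<close> for all \<open>n + 1 < e\<close>. For each such \<open>\<alpha>\<close> some alive cell has no alive child, as
  otherwise a branch of alive cells would lead to an uncovered point. There are only countably many
  positions, so arbitrarily many \<open>\<alpha>\<close> share this cell. Among its first \<open>N\<close> children for each of \<open>m\<close> such
  \<open>\<alpha>\<close>, the long intervals hit only a small fraction, as the children are equally spread, and
  each short one hits at most one child, as the children for different \<open>\<alpha>\<close> are disjoint. But all \<open>m N\<close>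
  children are hit by the first \<open>D N\<close> intervals, where \<open>D\<close> depends only on the cell. For large
  \<open>m\<close> this is absurd.
\<close>

section \<open>Microscopic sets form a \<open>\<sigma>\<close>-ideal\<close>

lemma power_two_times_odd_inject:
  fixes a b i j :: nat
  assumes "2 ^ a * (2 * i + 1) = 2 ^ b * (2 * j + 1)"
  shows "a = b \<and> i = j"
proof -
  have le: "b \<le> a" if "2 ^ a * (2 * i + 1) = 2 ^ b * (2 * j + 1)" for a b i j :: nat
  proof (rule ccontr)
    assume "\<not> b \<le> a"
    then obtain d where d: "b = a + Suc d"
      by (metis add_Suc_right less_imp_Suc_add not_le)
    have "2 ^ a * (2 * i + 1) = 2 ^ a * (2 * (2 ^ d * (2 * j + 1)))"
      using that unfolding d by (simp add: power_add algebra_simps)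
    then have "2 * i + 1 = 2 * (2 ^ d * (2 * j + 1))"
      by (metis mult_left_cancel power_not_zero zero_neq_numeral)
    then show False
      by presburger
  qed
  have "a = b"
    using le[OF assms] le[OF assms[symmetric]] by simp
  with assms show ?thesis
    by simp
qed

text \<open>Allows covers indexed by pairs or by tree nodes: an injective \<open>f\<close> places
  the intervals among the natural numbers, and the indices outside its image receive the empty
  interval.\<close>

lemma interval_cover_reindex:
  assumes int: "\<And>t. t \<in> T \<Longrightarrow> is_interval (I t)"
    and cov: "M \<subseteq> (\<Union>t\<in>T. I t)"
    and len: "\<And>t. t \<in> T \<Longrightarrow> interval_length (I t) \<le> ennreal (\<epsilon> ^ (f t + 1))"
    and inj: "inj_on f T"
  shows "\<exists>J :: nat \<Rightarrow> real set. (\<forall>n. is_interval (J n)) \<and> M \<subseteq> (\<Union>n. J n) \<and>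
           (\<forall>n. interval_length (J n) \<le> ennreal (\<epsilon> ^ (n + 1)))"
proof -
  define J where "J n = (if n \<in> f ` T then I (inv_into T f n) else {})" for n
  have Jf: "J (f t) = I t" if "t \<in> T" for t
    using that inj by (simp add: J_def)
  have "is_interval (J n)" for n
    by (auto simp: J_def inv_into_into intro: int)
  moreover have "M \<subseteq> (\<Union>n. J n)"
    using cov Jf by fastforce
  moreover have "interval_length (J n) \<le> ennreal (\<epsilon> ^ (n + 1))" for n
  proof (cases "n \<in> f ` T")
    case True
    then show ?thesis using Jf len by auto
  next
    case False
    then show ?thesis by (simp add: J_def interval_length_def)
  qed
  ultimately show ?thesis by blast
qed

lemma microscopic_UN:
  fixes A :: "nat \<Rightarrow> real set"
  assumes mic: "\<And>m. microscopic (A m)"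
  shows "microscopic (\<Union>m. A m)"
  unfolding microscopic_def
proof (intro allI impI)
  fix \<epsilon> :: real assume "\<epsilon> > 0"
  \<comment> \<open>Capping at 1 makes powers of \<open>\<delta>\<close> decrease in the exponent.
    Row \<open>m\<close> is covered with parameter \<open>\<delta> ^ (2 * 2 ^ m)\<close>, since
    \<open>2 * 2 ^ m * (k + 1)\<close> is at least \<open>2 ^ m * (2 * k + 1)\<close>, the new index
    plus one.\<close>
  define \<delta> where "\<delta> = min \<epsilon> 1"
  have \<delta>: "0 < \<delta>" "\<delta> \<le> 1" "\<delta> \<le> \<epsilon>"
    using \<open>\<epsilon> > 0\<close> by (auto simp: \<delta>_def)
  have "\<exists>J :: nat \<Rightarrow> real set. (\<forall>n. is_interval (J n)) \<and> A m \<subseteq> (\<Union>n. J n) \<and>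
          (\<forall>n. interval_length (J n) \<le> ennreal ((\<delta> ^ (2 * 2 ^ m)) ^ (n + 1)))" for m
    using mic[of m] \<delta>(1) unfolding microscopic_def by (meson zero_less_power)
  then obtain J :: "nat \<Rightarrow> nat \<Rightarrow> real set"
    where J: "\<And>m n. is_interval (J m n)" "\<And>m. A m \<subseteq> (\<Union>n. J m n)"
      "\<And>m n. interval_length (J m n) \<le> ennreal ((\<delta> ^ (2 * 2 ^ m)) ^ (n + 1))"
    by metis
  define f :: "nat \<times> nat \<Rightarrow> nat" where "f = (\<lambda>(m, k). 2 ^ m * (2 * k + 1) - 1)"
  have f: "f (m, k) + 1 = 2 ^ m * (2 * k + 1)" for m k
    by (simp add: f_def)
  show "\<exists>J :: nat \<Rightarrow> real set. (\<forall>n. is_interval (J n)) \<and> (\<Union>m. A m) \<subseteq> (\<Union>n. J n) \<and>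
          (\<forall>n. interval_length (J n) \<le> ennreal (\<epsilon> ^ (n + 1)))"
  proof (rule interval_cover_reindex[where T = UNIV and I = "\<lambda>(m, k). J m k" and f = f])
    show "inj f"
    proof (rule injI)
      fix x y assume "f x = f y"
      then show "x = y"
        using power_two_times_odd_inject f by (metis surj_pair)
    qed
    show "(\<Union>m. A m) \<subseteq> (\<Union>t. case t of (m, k) \<Rightarrow> J m k)"
      using J(2) by fastforce
    fix t :: "nat \<times> nat"
    obtain m k where t: "t = (m, k)" by force
    show "is_interval (case t of (m, k) \<Rightarrow> J m k)"
      using J(1) by (simp add: t)
    have "(\<delta> ^ (2 * 2 ^ m)) ^ (k + 1) = \<delta> ^ (2 * 2 ^ m * (k + 1))"
      by (simp only: power_mult)
    also have "\<dots> \<le> \<delta> ^ (f t + 1)"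
      unfolding t f using \<delta> by (intro power_decreasing) auto
    also have "\<dots> \<le> \<epsilon> ^ (f t + 1)"
      using \<delta> by (intro power_mono) auto
    finally show "interval_length (case t of (m, k) \<Rightarrow> J m k) \<le> ennreal (\<epsilon> ^ (f t + 1))"
      using J(3)[of m k] unfolding t by (auto intro: order_trans ennreal_leI)
  qed
qed

lemma microscopic_empty: "microscopic {}"
  unfolding microscopic_def
  by (intro allI impI exI[of _ "\<lambda>_. {}"]) (simp add: interval_length_def)

lemma microscopic_Union_countable:
  assumes "countable \<A>" "\<And>A. A \<in> \<A> \<Longrightarrow> microscopic A"
  shows "microscopic (\<Union>\<A>)"
proof (cases "\<A> = {}")
  case True
  then show ?thesis by (simp add: microscopic_empty)
next
  case False
  then obtain A :: "nat \<Rightarrow> real set" where "\<A> = range A"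
    using range_from_nat_into[OF False assms(1)] by metis
  then show ?thesis
    using microscopic_UN[of A] assms(2) by auto
qed

lemma interval_length_bounds_dist:
  assumes "is_interval J" "u \<in> J" "v \<in> J" "interval_length J \<le> ennreal c" "0 \<le> c"
  shows "\<bar>u - v\<bar> \<le> c"
proof -
  have meas: "J \<in> sets lborel"
    using real_interval_borel_measurable[OF assms(1)] by simp
  have "v - u \<le> c" if "u \<in> J" "v \<in> J" "u \<le> v" for u v
  proof -
    have "{u..v} \<subseteq> J"
      using mem_is_interval_1_I[OF assms(1) that(1,2)] by auto
    then have "emeasure lborel {u..v} \<le> emeasure lborel J"
      using meas by (intro emeasure_mono)
    with assms(4) have "ennreal (v - u) \<le> ennreal c"
      using that by (simp add: interval_length_def)
    then show ?thesis
      using assms(5) by simp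
  qed
  from this[of u v] this[of v u] assms show ?thesis by linarith
qed

section \<open>The sets \<open>limset \<alpha>\<close>\<close>

text \<open>
  A node is the list of the choices made so far, the latest one first. The code of a child has to
  be linear in its index \<open>i\<close>; this is why the quadratic \<open>prod_encode\<close> is not used.
\<close>

fun code :: "nat list \<Rightarrow> nat" where
  "code [] = 0"
| "code (i # s) = 2 ^ code s * (2 * i + 1)"

text \<open>\<open>(1 / 2) ^ expo s\<close> is the power \<open>code s + 1\<close> of
  \<open>(1 / 2) ^ (length s + 1)\<close>: the length allowed at index \<open>code s\<close>, for a
  parameter that shrinks with the level.\<close>

definition expo :: "nat list \<Rightarrow> nat" where
  "expo s = (length s + 1) * (code s + 1)"

text \<open>The characteristic function of \<alpha> below \<open>p\<close>, read as a binary number,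
  so that distinct sets are told apart by all large \<open>p\<close>.\<close>

definition digits :: "nat set \<Rightarrow> nat \<Rightarrow> nat" where
  "digits \<alpha> p = set_encode (\<alpha> \<inter> {..<p})"

text \<open>
  The \<open>2 ^ p\<close> children with index in \<open>{2 ^ p..<2 ^ (p + 1)}\<close> are placed on a grid of mesh \<open>4 ^ -p\<close>,
  roughly equally spaced; the offset \<open>digits \<alpha> p\<close> makes the positions for different \<open>\<alpha>\<close> disjoint.
\<close>

definition slot :: "nat set \<Rightarrow> nat \<Rightarrow> nat" where
  "slot \<alpha> i = (i - 2 ^ floor_log i) * 2 ^ floor_log i + digits \<alpha> (floor_log i)"

fun left :: "nat set \<Rightarrow> nat list \<Rightarrow> real" where
  "left \<alpha> [] = 0"
| "left \<alpha> (i # s) = left \<alpha> s + (1 / 2) ^ expo s * (real (slot \<alpha> i) / 4 ^ floor_log i)"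

definition cell :: "nat set \<Rightarrow> nat list \<Rightarrow> real set" where
  "cell \<alpha> s = {left \<alpha> s..left \<alpha> s + (1 / 2) ^ expo s}"

text \<open>The nodes chosen for different \<open>k\<close> need not lie on one branch; every branch
  nevertheless yields a point, by \<open>limset_nested\<close>.\<close>

definition limset :: "nat set \<Rightarrow> real set" where
  "limset \<alpha> = {x. \<forall>k. \<exists>s. length s = k \<and> x \<in> cell \<alpha> s}"

section \<open>Truncated binary expansions and codes of nodes\<close>

lemma digits_less: "digits \<alpha> p < 2 ^ p"
proof -
  have "digits \<alpha> p \<le> (\<Sum>k<p. 2 ^ k)"
    unfolding digits_def set_encode_def by (rule sum_mono2) auto
  also have "\<dots> < (2::nat) ^ p"
    by (simp add: sum_power2 lessThan_atLeast0)
  finally show ?thesis .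
qed

lemma eventually_inj_on_digits:
  assumes "finite B"
  shows "\<forall>\<^sub>F p in sequentially. inj_on (\<lambda>\<alpha>. digits \<alpha> p) B"
proof -
  have "\<forall>\<^sub>F p in sequentially. digits \<alpha> p = digits \<beta> p \<longrightarrow> \<alpha> = \<beta>" for \<alpha> \<beta>
  proof (cases "\<alpha> = \<beta>")
    case False
    then obtain k where k: "k \<in> \<alpha> \<longleftrightarrow> k \<notin> \<beta>" by blast
    show ?thesis
      unfolding eventually_sequentially
    proof (intro exI allI impI)
      fix p assume "Suc k \<le> p" "digits \<alpha> p = digits \<beta> p"
      then have "\<alpha> \<inter> {..<p} = \<beta> \<inter> {..<p}"
        by (simp add: digits_def set_encode_eq)
      then have "k \<in> \<alpha> \<inter> {..<p} \<longleftrightarrow> k \<in> \<beta> \<inter> {..<p}" by simp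
      with k \<open>Suc k \<le> p\<close> show "\<alpha> = \<beta>" by simp
    qed
  qed simp
  then have "\<forall>\<^sub>F p in sequentially. \<forall>\<alpha>\<in>B. \<forall>\<beta>\<in>B. digits \<alpha> p = digits \<beta> p \<longrightarrow> \<alpha> = \<beta>"
    using assms by (simp add: eventually_ball_finite_distrib)
  then show ?thesis
    by (simp add: inj_on_def)
qed

lemma code_inj: "inj_on code {s. length s = k}"
proof (induction k)
  case 0
  then show ?case by simp
next
  case (Suc k)
  show ?case
  proof (rule inj_onI)
    fix x y assume *: "x \<in> {s. length s = Suc k}" "y \<in> {s. length s = Suc k}" "code x = code y"
    then obtain i s j t where x: "x = i # s" "y = j # t" "length s = k" "length t = k"
      by (auto simp: length_Suc_conv)
    with * have "code s = code t \<and> i = j"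
      by (intro power_two_times_odd_inject) simp
    then show "x = y"
      using Suc.IH x by (auto simp: inj_on_def)
  qed
qed

text \<open>A single level suffices: the cells of level \<open>k\<close>, with
  \<open>(1 / 2) ^ k < \<epsilon>\<close>, are enumerated by \<open>code\<close>.\<close>

lemma microscopic_limset: "microscopic (limset \<alpha>)"
  unfolding microscopic_def
proof (intro allI impI)
  fix \<epsilon> :: real assume "\<epsilon> > 0"
  then obtain k where k: "(1 / 2) ^ k < \<epsilon>"
    using real_arch_pow_inv[of \<epsilon> "1 / 2"] by auto
  show "\<exists>J :: nat \<Rightarrow> real set. (\<forall>n. is_interval (J n)) \<and> limset \<alpha> \<subseteq> (\<Union>n. J n) \<and>
          (\<forall>n. interval_length (J n) \<le> ennreal (\<epsilon> ^ (n + 1)))"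
  proof (rule interval_cover_reindex[where T = "{s. length s = k}" and I = "cell \<alpha>" and f = code])
    show "inj_on code {s. length s = k}" by (rule code_inj)
    show "limset \<alpha> \<subseteq> (\<Union>s\<in>{s. length s = k}. cell \<alpha> s)"
      by (auto simp: limset_def)
    fix s :: "nat list" assume s: "s \<in> {s. length s = k}"
    show "is_interval (cell \<alpha> s)" by (simp add: cell_def is_interval_cc)
    have "(1 / 2 :: real) ^ expo s = ((1 / 2) ^ (k + 1)) ^ (code s + 1)"
      using s by (simp only: expo_def power_mult mem_Collect_eq)
    also have "\<dots> \<le> \<epsilon> ^ (code s + 1)"
    proof (rule power_mono)
      show "(1 / 2) ^ (k + 1) \<le> \<epsilon>"
        using k \<open>\<epsilon> > 0\<close> by simp
    qed simp
    finally show "interval_length (cell \<alpha> s) \<le> ennreal (\<epsilon> ^ (code s + 1))"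
      by (simp add: interval_length_def cell_def ennreal_leI)
  qed
qed

section \<open>Size and nesting of child cells\<close>

lemma expo_Cons_ge: "expo s + 4 * i + 2 \<le> expo (i # s)"
proof -
  define k c where "k = length s" and "c = code s"
  have c: "c + 2 \<le> 2 ^ c + 1" "1 \<le> (2::nat) ^ c"
    using less_exp[of c] by linarith simp
  have "(k + 1) * (c + 1) + 4 * i + 2 \<le> (k + 2) * (c + 2) + (k + 2) * (1 * (2 * i))"
    by (simp add: algebra_simps)
  also have "\<dots> \<le> (k + 2) * (2 ^ c + 1) + (k + 2) * (2 ^ c * (2 * i))"
    using c by (intro add_mono[of "(k + 2) * (c + 2)"] mult_le_mono order_refl)
  also have "\<dots> = expo (i # s)"
    by (simp add: expo_def k_def c_def algebra_simps)
  finally show ?thesis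
    by (simp add: expo_def k_def c_def)
qed

lemma expo_gt_length: "length s < expo s"
  by (simp add: expo_def)

lemma floor_log_le_self: "floor_log i \<le> i"
  by (cases "i = 0") (auto intro: order_trans[OF less_imp_le[OF less_exp] floor_log_exp2_le])

text \<open>In terms of the grid inside the parent, a child is at most a quarter of a step long, so
  children at distinct grid points are disjoint with room to spare.\<close>

lemma child_length_le:
  "(1 / 2 :: real) ^ expo (i # s) \<le> (1 / 2) ^ expo s / 4 ^ floor_log i / 4"
proof -
  have four: "(4 :: real) ^ p = 2 ^ (2 * p)" for p :: nat
    by (simp add: power_mult)
  have "(1 / 2 :: real) ^ expo (i # s) \<le> (1 / 2) ^ (expo s + 2 * floor_log i + 2)"
    using expo_Cons_ge[of s i] floor_log_le_self[of i] by (intro power_decreasing) auto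
  also have "\<dots> = (1 / 2) ^ expo s / 4 ^ floor_log i / 4"
    by (simp add: four power_add power_one_over field_simps)
  finally show ?thesis .
qed

lemma slot_less: "slot \<alpha> i < 4 ^ floor_log i"
proof -
  define p where "p = floor_log i"
  have j: "i - 2 ^ p < 2 ^ p"
    using floor_log_exp2_gt[of i] by (simp add: p_def less_diff_conv2 flip: mult_2)
  then have "(i - 2 ^ p) * 2 ^ p + digits \<alpha> p < (i - 2 ^ p) * 2 ^ p + 2 ^ p"
    using digits_less by simp
  also have "\<dots> = Suc (i - 2 ^ p) * 2 ^ p" by simp
  also have "\<dots> \<le> 2 ^ p * 2 ^ p"
    using j by (intro mult_le_mono) auto
  also have "\<dots> = 4 ^ p"
    by (simp flip: power_mult_distrib)
  finally show ?thesis
    by (simp add: slot_def p_def)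
qed

lemma cell_Cons_subset: "cell \<alpha> (i # s) \<subseteq> cell \<alpha> s"
proof -
  define l :: real where "l = (1 / 2) ^ expo s"
  define q :: real where "q = 4 ^ floor_log i"
  have q: "q > 0" and l: "l > 0" by (simp_all add: q_def l_def)
  have "real (slot \<alpha> i) + 1 \<le> q"
    using slot_less[of \<alpha> i] unfolding q_def
    by (metis Suc_eq_plus1 Suc_leI of_nat_1 of_nat_add of_nat_le_iff of_nat_numeral of_nat_power)
  then have "l * ((real (slot \<alpha> i) + 1) / q) \<le> l * 1"
    using q l by (intro mult_left_mono) auto
  moreover have "(1 / 2 :: real) ^ expo (i # s) \<le> l / q"
  proof -
    have "(1 / 2 :: real) ^ expo (i # s) \<le> l / q / 4"
      using child_length_le[of i s] by (simp add: l_def q_def)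
    also have "\<dots> \<le> l / q"
      using q l by (simp add: field_simps)
    finally show ?thesis .
  qed
  ultimately have "l * (real (slot \<alpha> i) / q) + (1 / 2) ^ expo (i # s) \<le> l"
    by (simp add: algebra_simps add_divide_distrib)
  moreover have "0 \<le> l * (real (slot \<alpha> i) / q)"
    using q l by simp
  ultimately show ?thesis
    by (auto simp: cell_def l_def q_def)
qed

text \<open>Leaves only countably many possible cell positions, as the later pigeonhole argument
  requires.\<close>

lemma left_rational: "left \<alpha> s \<in> \<rat>"
  by (induction s) auto

lemma limset_nested:
  assumes "\<And>k. length (b k) = k" and "\<And>k. \<exists>i. b (Suc k) = i # b k"
  obtains x where "x \<in> limset \<alpha>" "\<And>k. x \<in> cell \<alpha> (b k)"
proof -
  have "(\<Inter>k. cell \<alpha> (b k)) \<noteq> {}"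
  proof (rule compact_nest)
    show "compact (cell \<alpha> (b k))" "cell \<alpha> (b k) \<noteq> {}" for k
      by (simp_all add: cell_def)
    show "cell \<alpha> (b n) \<subseteq> cell \<alpha> (b m)" if "m \<le> n" for m n
      using that
    proof (induction rule: dec_induct)
      case (step k)
      then show ?case using assms(2)[of k] cell_Cons_subset by (metis order_trans)
    qed simp
  qed
  then obtain x where "\<And>k. x \<in> cell \<alpha> (b k)" by blast
  with assms(1) that show thesis
    by (fastforce simp: limset_def)
qed

section \<open>Counting the children that a sequence of short intervals can hit\<close>

lemma card_le_spread:
  fixes X :: "nat set"
  assumes "finite X" "\<And>x y. x \<in> X \<Longrightarrow> y \<in> X \<Longrightarrow> real x - real y \<le> r" "0 \<le> r"
  shows "real (card X) \<le> r + 1"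
proof (cases "X = {}")
  case False
  have "card X \<le> card {Min X..Max X}"
    using assms(1) by (intro card_mono) auto
  then have "card X + Min X \<le> Max X + 1"
    using Max_ge[OF assms(1) Min_in[OF assms(1) False]] by simp
  then have "real (card X) \<le> real (Max X) - real (Min X) + 1"
    by linarith
  also have "\<dots> \<le> r + 1"
    using assms False by simp
  finally show ?thesis .
qed (use assms in simp)

lemma left_block:
  assumes "j < 2 ^ p"
  shows "left \<alpha> ((2 ^ p + j) # s) =
    left \<alpha> s + (1 / 2) ^ expo s * (real (j * 2 ^ p + digits \<alpha> p) / 4 ^ p)"
    and "floor_log (2 ^ p + j) = p"
proof -
  show "floor_log (2 ^ p + j) = p"
    using assms by (intro floor_log_eqI) auto
  then show "left \<alpha> ((2 ^ p + j) # s) =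
    left \<alpha> s + (1 / 2) ^ expo s * (real (j * 2 ^ p + digits \<alpha> p) / 4 ^ p)"
    by (simp add: slot_def)
qed

text \<open>In units of the grid step \<open>(1 / 2) ^ expo s / 4 ^ p\<close>, a child has length at
  most 1/4, which is the additive term. \<alpha> and \<beta> may differ, but their cells at
  \<open>s\<close> coincide.\<close>

lemma dist_left_block:
  assumes j: "j < 2 ^ p" "k < 2 ^ p" and s: "left \<alpha> s = left \<beta> s"
    and u: "u \<in> cell \<alpha> ((2 ^ p + j) # s)" and v: "v \<in> cell \<beta> ((2 ^ p + k) # s)"
    and uv: "\<bar>u - v\<bar> \<le> r"
  shows "\<bar>real (j * 2 ^ p + digits \<alpha> p) - real (k * 2 ^ p + digits \<beta> p)\<bar>
    \<le> r * 4 ^ p * 2 ^ expo s + 1 / 4"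
proof -
  define l :: real where "l = (1 / 2) ^ expo s"
  have l: "l > 0" by (simp add: l_def)
  define x y where "x = real (j * 2 ^ p + digits \<alpha> p)" and "y = real (k * 2 ^ p + digits \<beta> p)"
  have u': "left \<alpha> s + l * (x / 4 ^ p) \<le> u" "u \<le> left \<alpha> s + l * (x / 4 ^ p) + l / 4 ^ p / 4"
    using u child_length_le[of "2 ^ p + j" s] left_block[OF j(1)]
    by (auto simp: cell_def l_def x_def)
  have v': "left \<alpha> s + l * (y / 4 ^ p) \<le> v" "v \<le> left \<alpha> s + l * (y / 4 ^ p) + l / 4 ^ p / 4"
    using v child_length_le[of "2 ^ p + k" s] left_block[OF j(2)] s
    by (auto simp: cell_def l_def y_def)
  have "\<bar>l * (x / 4 ^ p) - l * (y / 4 ^ p)\<bar> \<le> r + l / 4 ^ p / 4"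
    using u' v' uv by linarith
  then have "\<bar>l * ((x - y) / 4 ^ p)\<bar> \<le> r + l / 4 ^ p / 4"
    by (simp add: algebra_simps diff_divide_distrib)
  then have "l * (\<bar>x - y\<bar> / 4 ^ p) \<le> r + l / 4 ^ p / 4"
    using l by (simp add: abs_mult)
  then have "\<bar>x - y\<bar> \<le> r * 4 ^ p / l + 1 / 4"
    using l by (simp add: field_simps)
  then show ?thesis
    by (simp add: l_def x_def y_def power_one_over)
qed

text \<open>For a single \<alpha> the offsets cancel and consecutive children are
  \<open>2 ^ p\<close> grid steps apart. One unit of the additive 2 absorbs the child length, the
  other comes from counting integers in a range.\<close>

lemma card_hit_children_le:
  assumes dist: "\<And>u v. u \<in> J \<Longrightarrow> v \<in> J \<Longrightarrow> \<bar>u - v\<bar> \<le> r" and "0 \<le> r"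
  shows "real (card {j. j < 2 ^ p \<and> J \<inter> cell \<alpha> ((2 ^ p + j) # s) \<noteq> {}})
    \<le> r * 2 ^ p * 2 ^ expo s + 2"
proof -
  have "real (card {j. j < 2 ^ p \<and> J \<inter> cell \<alpha> ((2 ^ p + j) # s) \<noteq> {}})
    \<le> (r * 2 ^ p * 2 ^ expo s + 1) + 1"
  proof (rule card_le_spread)
    fix j k
    assume "j \<in> {j. j < 2 ^ p \<and> J \<inter> cell \<alpha> ((2 ^ p + j) # s) \<noteq> {}}"
      "k \<in> {j. j < 2 ^ p \<and> J \<inter> cell \<alpha> ((2 ^ p + j) # s) \<noteq> {}}"
    then obtain u v where j: "j < 2 ^ p" "k < 2 ^ p"
      and u: "u \<in> J" "u \<in> cell \<alpha> ((2 ^ p + j) # s)"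
      and v: "v \<in> J" "v \<in> cell \<alpha> ((2 ^ p + k) # s)"
      by blast
    have "(real j - real k) * 2 ^ p \<le> r * 4 ^ p * 2 ^ expo s + 1 / 4"
      using dist_left_block[OF j refl u(2) v(2) dist[OF u(1) v(1)]]
      by (simp add: algebra_simps)
    also have "\<dots> = (r * 2 ^ p * 2 ^ expo s) * 2 ^ p + 1 / 4"
      by (simp add: algebra_simps flip: power_mult_distrib)
    also have "\<dots> \<le> (r * 2 ^ p * 2 ^ expo s) * 2 ^ p + 1 * 2 ^ p"
      using one_le_power[of "2 :: real" p] by linarith
    also have "\<dots> = (r * 2 ^ p * 2 ^ expo s + 1) * 2 ^ p"
      by (simp add: algebra_simps)
    finally show "real j - real k \<le> r * 2 ^ p * 2 ^ expo s + 1"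
      by simp
  qed (use \<open>0 \<le> r\<close> in auto)
  then show ?thesis by simp
qed

text \<open>Double counting of pairs of a set in \<open>B\<close> and one of its
  \<open>2 ^ p\<close> children: long intervals hit at most half of the pairs, short ones at most
  \<open>D * 2 ^ p\<close>. Dividing by \<open>2 ^ p\<close> leaves a bound free of
  \<open>p\<close>.\<close>

lemma card_dead_le:
  assumes dist: "\<And>n u v. u \<in> J n \<Longrightarrow> v \<in> J n \<Longrightarrow> \<bar>u - v\<bar> \<le> (1 / 2) ^ (n + 4)"
    and fin: "finite B"
    and left: "\<And>\<alpha>. \<alpha> \<in> B \<Longrightarrow> left \<alpha> s = a"
    and inj: "inj_on (\<lambda>\<alpha>. digits \<alpha> p) B"
    and alive: "\<And>\<alpha> n. \<alpha> \<in> B \<Longrightarrow> n + 1 < expo s \<Longrightarrow> J n \<inter> cell \<alpha> s = {}"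
    and dead: "\<And>\<alpha> i. \<alpha> \<in> B \<Longrightarrow> \<exists>n. n + 1 < expo (i # s) \<and> J n \<inter> cell \<alpha> (i # s) \<noteq> {}"
    and p: "8 \<le> p"
  shows "card B \<le> 10 * (length s + 2) * 2 ^ code s"
proof -
  \<comment> \<open>Since \<open>code\<close> is linear in the child index, all exponents in the
    block are at most \<open>D * 2 ^ p\<close>; the 5 is 4 from \<open>2 * (2 ^ p + j) + 1\<close>
    and 1 from the summand in \<open>expo\<close>.\<close>
  define D where "D = 5 * (length s + 2) * 2 ^ code s"
  define e where "e = expo s"
  have "e > 0" by (simp add: e_def expo_def)
  define K where "K = B \<times> {..<(2::nat) ^ p}"
  define H where "H n = {(\<alpha>, j) \<in> K. J n \<inter> cell \<alpha> ((2 ^ p + j) # s) \<noteq> {}}" for n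
  have finK: "finite K" using fin by (simp add: K_def)
  have finH: "finite (H n)" for n
    using finK by (rule finite_subset[rotated]) (auto simp: H_def)
  have expo_le: "expo ((2 ^ p + j) # s) \<le> D * 2 ^ p" if "j < 2 ^ p" for j
  proof -
    define c :: nat where "c = 2 ^ code s"
    have "1 * 1 \<le> c * 2 ^ p" unfolding c_def by (intro mult_le_mono) auto
    moreover have "c * (2 * (2 ^ p + j) + 1) \<le> c * (4 * 2 ^ p)"
      using that by (intro mult_le_mono) auto
    ultimately have "c * (2 * (2 ^ p + j) + 1) + 1 \<le> 5 * (c * 2 ^ p)"
      by linarith
    then have "(length s + 2) * (c * (2 * (2 ^ p + j) + 1) + 1) \<le> (length s + 2) * (5 * (c * 2 ^ p))"
      by (rule mult_le_mono2)
    then show ?thesis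
      by (simp add: expo_def D_def c_def algebra_simps)
  qed
  \<comment> \<open>Intervals with \<open>n + 1 < e\<close> miss the parent cell and hence the
    children. The cut at \<open>e + 2 * p\<close> is where the intervals become shorter than a grid
    step.\<close>
  have "K \<subseteq> (\<Union>q<2 * p + 1. H (e - 1 + q)) \<union> (\<Union>n\<in>{e + 2 * p..<D * 2 ^ p}. H n)"
  proof clarify
    fix \<alpha> j assume K: "(\<alpha>, j) \<in> K"
      and no: "(\<alpha>, j) \<notin> (\<Union>n\<in>{e + 2 * p..<D * 2 ^ p}. H n)"
    then have aj: "\<alpha> \<in> B" "j < 2 ^ p" by (auto simp: K_def)
    obtain n where n: "n + 1 < expo ((2 ^ p + j) # s)" "J n \<inter> cell \<alpha> ((2 ^ p + j) # s) \<noteq> {}"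
      using dead aj by blast
    then have H: "(\<alpha>, j) \<in> H n" using K by (simp add: H_def)
    have "\<not> n + 1 < e"
      using alive[OF aj(1), of n] n(2) cell_Cons_subset[of \<alpha> "2 ^ p + j" s] by (auto simp: e_def)
    moreover have "n < e + 2 * p"
      using no H n(1) expo_le[OF aj(2)] by force
    ultimately have "n = e - 1 + (n - (e - 1))" "n - (e - 1) < 2 * p + 1"
      using \<open>e > 0\<close> by auto
    with H show "(\<alpha>, j) \<in> (\<Union>q<2 * p + 1. H (e - 1 + q))"
      by (metis UN_I lessThan_iff)
  qed
  then have "card K \<le> card ((\<Union>q<2 * p + 1. H (e - 1 + q)) \<union> (\<Union>n\<in>{e + 2 * p..<D * 2 ^ p}. H n))"
    using finH by (intro card_mono) auto
  also have "\<dots> \<le> card (\<Union>q<2 * p + 1. H (e - 1 + q)) + card (\<Union>n\<in>{e + 2 * p..<D * 2 ^ p}. H n)"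
    by (rule card_Un_le)
  also have "\<dots> \<le> (\<Sum>q<2 * p + 1. card (H (e - 1 + q))) + (\<Sum>n\<in>{e + 2 * p..<D * 2 ^ p}. card (H n))"
    by (intro add_mono card_UN_le) auto
  also have "(\<Sum>n\<in>{e + 2 * p..<D * 2 ^ p}. card (H n)) \<le> (\<Sum>n\<in>{e + 2 * p..<D * 2 ^ p}. 1)"
  proof (rule sum_mono)
    fix n assume n: "n \<in> {e + 2 * p..<D * 2 ^ p}"
    have "x = y" if xy: "x \<in> H n" "y \<in> H n" for x y
    proof -
      obtain \<alpha> j \<beta> k where x: "x = (\<alpha>, j)" "y = (\<beta>, k)" by force
      with xy obtain u v where B: "\<alpha> \<in> B" "\<beta> \<in> B" and j: "j < 2 ^ p" "k < 2 ^ p"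
        and u: "u \<in> J n" "u \<in> cell \<alpha> ((2 ^ p + j) # s)"
        and v: "v \<in> J n" "v \<in> cell \<beta> ((2 ^ p + k) # s)"
        by (auto simp: H_def K_def)
      have "(1 / 2 :: real) ^ (n + 4) \<le> (1 / 2) ^ (e + 2 * p + 4)"
        using n by (intro power_decreasing) auto
      also have "\<dots> = 1 / (4 ^ p * 2 ^ e) / 16"
        by (simp add: power_add power_mult power_one_over)
      finally have "(1 / 2 :: real) ^ (n + 4) * 4 ^ p * 2 ^ e \<le> 1 / 16"
        by (simp add: field_simps)
      moreover have "\<bar>real (j * 2 ^ p + digits \<alpha> p) - real (k * 2 ^ p + digits \<beta> p)\<bar>
        \<le> (1 / 2) ^ (n + 4) * 4 ^ p * 2 ^ e + 1 / 4"
        unfolding e_def using left[OF B(1)] left[OF B(2)]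
        by (intro dist_left_block[OF j _ u(2) v(2) dist[OF u(1) v(1)]]) simp
      ultimately have "\<bar>real (j * 2 ^ p + digits \<alpha> p) - real (k * 2 ^ p + digits \<beta> p)\<bar> < 1"
        by linarith
      \<comment> \<open>Grid points less than one step apart coincide. The quotient by
        \<open>2 ^ p\<close> then returns the child index and the remainder the offset, which
        determines the set in \<open>B\<close>.\<close>
      then have eq: "j * 2 ^ p + digits \<alpha> p = k * 2 ^ p + digits \<beta> p"
        by linarith
      have "j = (j * 2 ^ p + digits \<alpha> p) div 2 ^ p" "k = (k * 2 ^ p + digits \<beta> p) div 2 ^ p"
        by (simp_all add: digits_less)
      with eq have "j = k" by simp
      with eq have "digits \<alpha> p = digits \<beta> p" by simp
      with inj B have "\<alpha> = \<beta>" by (auto dest: inj_onD)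
      with \<open>j = k\<close> x show ?thesis by simp
    qed
    then show "card (H n) \<le> 1"
      using finH[of n] by (simp add: card_le_Suc0_iff_eq)
  qed
  finally have "card K \<le> (\<Sum>q<2 * p + 1. card (H (e - 1 + q))) + D * 2 ^ p"
    by simp
  then have "real (card K) \<le> real ((\<Sum>q<2 * p + 1. card (H (e - 1 + q))) + D * 2 ^ p)"
    by (simp only: of_nat_le_iff)
  then have "real (card K) \<le> (\<Sum>q<2 * p + 1. real (card (H (e - 1 + q)))) + real D * 2 ^ p"
    by simp
  also have "(\<Sum>q<2 * p + 1. real (card (H (e - 1 + q))))
    \<le> (\<Sum>q<2 * p + 1. real (card B) * (2 ^ p / 8 * (1 / 2) ^ q + 2))"
  proof (rule sum_mono)
    fix q
    define r :: real where "r = (1 / 2) ^ (e - 1 + q + 4)"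
    have "r = (1 / 2) ^ (e + (3 + q))"
      using \<open>e > 0\<close> unfolding r_def by (intro arg_cong2[where f = power]) auto
    then have r: "r * 2 ^ p * 2 ^ e = 2 ^ p / 8 * (1 / 2) ^ q"
      by (simp add: power_add power_one_over field_simps)
    have "H (e - 1 + q) =
      (SIGMA \<alpha>:B. {j. j < 2 ^ p \<and> J (e - 1 + q) \<inter> cell \<alpha> ((2 ^ p + j) # s) \<noteq> {}})"
      by (auto simp: H_def K_def)
    then have "real (card (H (e - 1 + q))) =
      (\<Sum>\<alpha>\<in>B. real (card {j. j < 2 ^ p \<and> J (e - 1 + q) \<inter> cell \<alpha> ((2 ^ p + j) # s) \<noteq> {}}))"
      using fin by (simp add: card_SigmaI)
    also have "\<dots> \<le> (\<Sum>\<alpha>\<in>B. r * 2 ^ p * 2 ^ e + 2)"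
      unfolding e_def by (intro sum_mono card_hit_children_le)
        (use dist in \<open>auto simp: r_def e_def\<close>)
    finally show "real (card (H (e - 1 + q))) \<le> real (card B) * (2 ^ p / 8 * (1 / 2) ^ q + 2)"
      by (simp add: r)
  qed
  also have "\<dots> = real (card B) * (2 ^ p / 8 * (\<Sum>q<2 * p + 1. (1 / 2) ^ q) + 2 * real (2 * p + 1))"
    by (simp only: sum.distrib sum_distrib_left[symmetric] sum_constant card_lessThan mult.commute[of _ "2 :: real"])
  also have "\<dots> \<le> real (card B) * (2 ^ p / 8 * 2 + 2 * real (2 * p + 1))"
  proof -
    have "(\<Sum>q<2 * p + 1. (1 / 2 :: real) ^ q) \<le> 2"
      by (subst sum_gp_strict) simp
    then show ?thesis
      by (intro mult_left_mono add_right_mono) auto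
  qed
  \<comment> \<open>The geometric series contributes one quarter; \<open>8 \<le> p\<close> makes the
    additive errors of the \<open>2 * p + 1\<close> long intervals at most another.\<close>
  also have "\<dots> \<le> real (card B) * (2 ^ p / 4 + 2 ^ p / 4)"
  proof -
    have "8 * (2 * p + 1) \<le> (2::nat) ^ p"
      using p by (induction p rule: dec_induct) auto
    then have "real (8 * (2 * p + 1)) \<le> real (2 ^ p)"
      by (simp only: of_nat_le_iff)
    then show ?thesis
      by (intro mult_left_mono) auto
  qed
  finally have "real (card K) \<le> real (card B) * (2 ^ p / 2) + real D * 2 ^ p"
    by simp
  moreover have "real (card K) = real (card B) * 2 ^ p"
    by (simp add: K_def card_cartesian_product)
  ultimately have "real (card B) * 2 ^ p \<le> (2 * real D) * 2 ^ p"
    by (simp only: times_divide_eq_right)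
  then have "real (card B) \<le> real (2 * D)"
    by simp
  then have "card B \<le> 2 * D"
    by (simp only: of_nat_le_iff)
  then show ?thesis
    by (simp add: D_def mult.assoc[symmetric])
qed

section \<open>The additivity\<close>

text \<open>Otherwise alive children can be chosen forever, starting at the root, which is alive
  vacuously because its exponent is 1. At depth \<open>n + 1\<close> the exponent exceeds
  \<open>n + 1\<close>, so the limit point avoids every \<open>J n\<close>.\<close>

lemma exists_dead_node:
  assumes cov: "limset \<alpha> \<subseteq> (\<Union>n. J n)"
  obtains s where "\<And>n. n + 1 < expo s \<Longrightarrow> J n \<inter> cell \<alpha> s = {}"
    and "\<And>i. \<exists>n. n + 1 < expo (i # s) \<and> J n \<inter> cell \<alpha> (i # s) \<noteq> {}"
proof -
  define alive where "alive s \<longleftrightarrow> (\<forall>n. n + 1 < expo s \<longrightarrow> J n \<inter> cell \<alpha> s = {})" for s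
  have "\<exists>s. alive s \<and> (\<forall>i. \<not> alive (i # s))"
  proof (rule ccontr)
    assume "\<not> ?thesis"
    then have "\<forall>s. \<exists>i. alive s \<longrightarrow> alive (i # s)" by blast
    then obtain h where h: "\<And>s. alive s \<Longrightarrow> alive (h s # s)" by metis
    define b where "b = rec_nat [] (\<lambda>_ s. h s # s)"
    have b: "b 0 = []" "b (Suc k) = h (b k) # b k" for k
      by (simp_all add: b_def)
    have len: "length (b k) = k" for k by (induction k) (simp_all add: b)
    have alive: "alive (b k)" for k
      by (induction k) (auto simp: b h alive_def[of "[]"] expo_def)
    obtain x where x: "x \<in> limset \<alpha>" "\<And>k. x \<in> cell \<alpha> (b k)"
      using limset_nested[of b \<alpha>] len b by blast
    obtain n where "x \<in> J n" using cov x(1) by blast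
    moreover have "n + 1 < expo (b (n + 1))"
      using expo_gt_length[of "b (n + 1)"] len by simp
    ultimately show False
      using alive[of "n + 1"] x(2)[of "n + 1"] unfolding alive_def by blast
  qed
  then show thesis
    using that unfolding alive_def by blast
qed

lemma not_microscopic_UN_limset:
  assumes "uncountable L"
  shows "\<not> microscopic (\<Union>\<alpha>\<in>L. limset \<alpha>)"
proof
  assume "microscopic (\<Union>\<alpha>\<in>L. limset \<alpha>)"
  \<comment> \<open>With parameter 1/16 the lengths are \<open>(1 / 2) ^ (4 * (n + 1))\<close>, at
    most \<open>(1 / 2) ^ (n + 4)\<close>, as the counting lemma demands.\<close>
  then have "\<exists>J :: nat \<Rightarrow> real set. (\<forall>n. is_interval (J n)) \<and> (\<Union>\<alpha>\<in>L. limset \<alpha>) \<subseteq> (\<Union>n. J n) \<and>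
      (\<forall>n. interval_length (J n) \<le> ennreal ((1 / 16) ^ (n + 1)))"
    unfolding microscopic_def by (rule allE[of _ "1 / 16"]) simp_all
  then obtain J :: "nat \<Rightarrow> real set" where J: "\<And>n. is_interval (J n)"
    "(\<Union>\<alpha>\<in>L. limset \<alpha>) \<subseteq> (\<Union>n. J n)"
    "\<And>n. interval_length (J n) \<le> ennreal ((1 / 16) ^ (n + 1))"
    by blast
  have dist: "\<bar>u - v\<bar> \<le> (1 / 2) ^ (n + 4)" if "u \<in> J n" "v \<in> J n" for n u v
  proof -
    have "\<bar>u - v\<bar> \<le> (1 / 16) ^ (n + 1)"
      using J(1) that J(3) by (rule interval_length_bounds_dist) simp
    also have "\<dots> = ((1 / 2) ^ 4) ^ (n + 1)"
      by (simp add: power_one_over)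
    also have "\<dots> = (1 / 2) ^ (4 * (n + 1))"
      by (simp only: power_mult)
    also have "\<dots> \<le> (1 / 2) ^ (n + 4)"
      by (intro power_decreasing) auto
    finally show ?thesis .
  qed
  have "\<forall>\<alpha>\<in>L. \<exists>s. (\<forall>n. n + 1 < expo s \<longrightarrow> J n \<inter> cell \<alpha> s = {}) \<and>
      (\<forall>i. \<exists>n. n + 1 < expo (i # s) \<and> J n \<inter> cell \<alpha> (i # s) \<noteq> {})"
    using exists_dead_node J(2) by (metis SUP_le_iff)
  then obtain S where "\<forall>\<alpha>\<in>L. (\<forall>n. n + 1 < expo (S \<alpha>) \<longrightarrow> J n \<inter> cell \<alpha> (S \<alpha>) = {}) \<and>
      (\<forall>i. \<exists>n. n + 1 < expo (i # S \<alpha>) \<and> J n \<inter> cell \<alpha> (i # S \<alpha>) \<noteq> {})"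
    by (rule bchoice[THEN exE])
  then have S: "\<And>\<alpha> n. \<alpha> \<in> L \<Longrightarrow> n + 1 < expo (S \<alpha>) \<Longrightarrow> J n \<inter> cell \<alpha> (S \<alpha>) = {}"
      "\<And>\<alpha> i. \<alpha> \<in> L \<Longrightarrow> \<exists>n. n + 1 < expo (i # S \<alpha>) \<and> J n \<inter> cell \<alpha> (i # S \<alpha>) \<noteq> {}"
    by blast+
  define F where "F s a = {\<alpha> \<in> L. S \<alpha> = s \<and> left \<alpha> s = a}" for s a
  have "L \<subseteq> (\<Union>s. \<Union>a\<in>\<rat>. F s a)"
    using left_rational by (auto simp: F_def)
  moreover have "countable (\<Union>s. \<Union>a\<in>\<rat>. F s a)" if "\<And>s a. finite (F s a)"
    using that by (intro countable_UN countable_rat) (auto intro: countable_finite)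
  ultimately obtain s a where "infinite (F s a)"
    using assms countable_subset by blast
  \<comment> \<open>One element more than the counting bound. As that bound does not involve
    \<open>p\<close>, the value of \<open>p\<close> may be chosen after \<open>B\<close>, large
    enough to separate its members.\<close>
  then obtain B where B: "B \<subseteq> F s a" "finite B" "card B = 10 * (length s + 2) * 2 ^ code s + 1"
    by (meson infinite_arbitrarily_large)
  have "\<forall>\<^sub>F p in sequentially. inj_on (\<lambda>\<alpha>. digits \<alpha> p) B \<and> 8 \<le> p"
    using eventually_inj_on_digits[OF B(2)] eventually_ge_at_top by (rule eventually_conj)
  then obtain p where p: "inj_on (\<lambda>\<alpha>. digits \<alpha> p) B" "8 \<le> p"
    using eventually_happens'[OF sequentially_bot] by blast
  have "card B \<le> 10 * (length s + 2) * 2 ^ code s"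
  proof (rule card_dead_le[OF dist B(2) _ p(1) _ _ p(2), where a = a])
    fix \<alpha> assume "\<alpha> \<in> B"
    then have \<alpha>: "\<alpha> \<in> L" "S \<alpha> = s" "left \<alpha> s = a"
      using B(1) by (auto simp: F_def)
    show "left \<alpha> s = a" by fact
    show "J n \<inter> cell \<alpha> s = {}" if "n + 1 < expo s" for n
      using S(1)[of \<alpha> n] \<alpha> that by simp
    show "\<exists>n. n + 1 < expo (i # s) \<and> J n \<inter> cell \<alpha> (i # s) \<noteq> {}" for i
      using S(2)[of \<alpha> i] \<alpha> by simp
  qed
  then show False using B(3) by simp
qed

section \<open>Uncountability and the exact value of the additivity\<close>

lemma omega1_ordLeq_iff_uncountable: "omega1 \<le>o |A| \<longleftrightarrow> uncountable A"
  unfolding omega1_def countable_card_le_natLeq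
    cardSuc_ordLess_ordLeq[OF natLeq_Card_order card_of_Card_order, symmetric]
  by (rule not_ordLeq_iff_ordLess[OF natLeq_Well_order card_of_Well_order, symmetric])

theorem theorem3p2: "has_additivity {M. microscopic M} omega1"
  unfolding has_additivity_def
proof (intro conjI allI impI)
  show lower: "omega1 \<le>o |\<A>|" if "\<A> \<subseteq> {M. microscopic M} \<and> \<Union>\<A> \<notin> {M. microscopic M}" for \<A>
    using that microscopic_Union_countable[of \<A>] by (auto simp: omega1_ordLeq_iff_uncountable)
  \<comment> \<open>The successor of \<open>natLeq\<close> lives on \<open>nat set\<close>, so its
    field is already a family of sets of naturals and can index the sets
    \<open>limset \<alpha>\<close>.\<close>
  define L where "L = Field omega1"
  have "Card_order omega1"
    unfolding omega1_def by (rule cardSuc_Card_order[OF natLeq_Card_order])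
  then have L: "|L| =o omega1"
    unfolding L_def by (rule card_of_Field_ordIso)
  then have "uncountable L"
    by (simp flip: omega1_ordLeq_iff_uncountable add: ordIso_imp_ordLeq ordIso_symmetric)
  then have nm: "\<not> microscopic (\<Union>(limset ` L))"
    by (rule not_microscopic_UN_limset)
  show "\<exists>\<A>. \<A> \<subseteq> {M. microscopic M} \<and> \<Union>\<A> \<notin> {M. microscopic M} \<and> |\<A>| =o omega1"
  proof (intro exI conjI)
    show sub: "limset ` L \<subseteq> {M. microscopic M}"
      using microscopic_limset by blast
    show notin: "\<Union>(limset ` L) \<notin> {M. microscopic M}"
      using nm by simp
    \<comment> \<open>The image could a priori be smaller than \<open>L\<close>; the reverse
      inequality comes from \<open>lower\<close>, because the union is not microscopic.\<close>
    have "|limset ` L| \<le>o omega1"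
      using card_of_image L by (rule ordLeq_ordIso_trans)
    then show "|limset ` L| =o omega1"
      using lower[of "limset ` L"] sub notin by (simp add: ordIso_iff_ordLeq)
  qed
qed

end
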